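(* Let $m\ge 0$, $n=m+3$, and let $(f_{i,j},\varphi_{i,j})$ be a generic superfrieze of width $m$ with entries in a supercommutative ring. Then $$\varphi_{i+n,j+n}=-\varphi_{i,j},\qquad f_{i+n,j+n}=f_{i,j}$$ for all $i,j\in\mathbb{Z}$ for which the entries are part of the array. In particular, the entries $a_i=f_{i,i}$, $\beta_i=\varphi_{i,i}$ of the first two rows satisfy $a_{i+n}=a_i$ and $\beta_{i+n}=-\beta_i$ for all $i\in\mathbb{Z}$.
   Context: Supercommutative ring: $\mathcal{R}=\mathcal{R}_{\bar0}\oplus\mathcal{R}_{\bar1}$ is $\mathbb{Z}/2$-graded; even elements are central, odd elements anticommute with each other and square to zero. Superfrieze of width $m$: an array consisting of even entries $f_{i,j}\in\mathcal{R}_{\bar0}$, for $i,j\in\mathbb{Z}$ with $-2\le j-i\le m+1$, and odd entries $\varphi_{i,j}\in\mathcal{R}_{\bar1}$, for $i,j$ both in $\mathbb{Z}$ or both in $\mathbb{Z}+\frac12$ with $-1\le j-i\le m+1$, such that: (Boundary) $f_{i,i-2}=0$, $f_{i,i-1}=1$, $f_{i,i+m}=1$, $f_{i,i+m+1}=0$ for all $i\in\mathbb{Z}$, and $\varphi_{i,i-1}=0=\varphi_{i,i+m+1}$ for all $i\in\frac12\mathbb{Z}$. (Frieze rule) for all $i,j\in\mathbb{Z}$ with $-1\le j-i\le m$, setting $A=f_{i,j}$, $B=f_{i+1,j}$, $C=f_{i,j+1}$, $D=f_{i+1,j+1}$, $\Xi=\varphi_{i+\frac12,j+\frac12}$, $\Psi=\varphi_{i+1,j+1}$,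 $\Phi=\varphi_{i,j+1}$, $\Sigma=\varphi_{i+\frac12,j+\frac32}$, one has $$AD-BC=1+\Sigma\Xi,\qquad A\Sigma-C\Xi=\Phi,\qquad B\Sigma-D\Xi=\Psi.$$ A superfrieze is generic if every even entry $f_{i,j}$ strictly inside the boundary rows (i.e. $0\le j-i\le m-1$) is invertible in $\mathcal{R}$. *)

theory Defs
  imports Complex_Main
begin

text \<open>
  The sort \<open>{ring, monoid_mult}\<close> describes associative unital rings that are not assumed
  commutative. Unlike \<open>ring_1\<close> it does not exclude the zero ring.
  The sets \<open>R0\<close> and \<open>R1\<close> are the even and the odd part.
\<close>

locale supercommutative_ring =
  fixes R0 R1 :: "'a::{ring, monoid_mult} set"
  assumes even_zero: "0 \<in> R0"
    and even_diff: "x \<in> R0 \<Longrightarrow> y \<in> R0 \<Longrightarrow> x - y \<in> R0"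
    and odd_zero: "0 \<in> R1"
    and odd_diff: "x \<in> R1 \<Longrightarrow> y \<in> R1 \<Longrightarrow> x - y \<in> R1"
    and decomposition: "\<exists>x0\<in>R0. \<exists>x1\<in>R1. x = x0 + x1"
    and direct: "R0 \<inter> R1 = {0}"
    and one_even: "1 \<in> R0"
    and even_even: "x \<in> R0 \<Longrightarrow> y \<in> R0 \<Longrightarrow> x * y \<in> R0"
    and even_odd: "x \<in> R0 \<Longrightarrow> y \<in> R1 \<Longrightarrow> x * y \<in> R1"
    and odd_even: "x \<in> R1 \<Longrightarrow> y \<in> R0 \<Longrightarrow> x * y \<in> R1"
    and odd_odd: "x \<in> R1 \<Longrightarrow> y \<in> R1 \<Longrightarrow> x * y \<in> R0"
    and even_central: "x \<in> R0 \<Longrightarrow> x * y = y * x"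
    and odd_anticommute: "x \<in> R1 \<Longrightarrow> y \<in> R1 \<Longrightarrow> x * y = - (y * x)"
    and odd_square: "x \<in> R1 \<Longrightarrow> x * x = 0"

definition half_integer_pair :: "rat \<Rightarrow> rat \<Rightarrow> bool" where
  "half_integer_pair i j \<longleftrightarrow>
     (i \<in> \<int> \<and> j \<in> \<int>) \<or> (i - 1/2 \<in> \<int> \<and> j - 1/2 \<in> \<int>)"

text \<open>
  The array is given by total functions; only the values in the index ranges stated below
  are constrained, values outside are irrelevant. The odd entries are indexed by rational
  numbers, so that the indices in the frieze rule appear literally.
\<close>

locale superfrieze = supercommutative_ring R0 R1
  for R0 R1 :: "'a::{ring, monoid_mult} set" +
  fixes m :: nat
    and f :: "int \<Rightarrow> int \<Rightarrow> 'a"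
    and \<phi> :: "rat \<Rightarrow> rat \<Rightarrow> 'a"
  assumes f_even: "-2 \<le> j - i \<Longrightarrow> j - i \<le> int m + 1 \<Longrightarrow> f i j \<in> R0"
    and phi_odd: "half_integer_pair p q \<Longrightarrow> -1 \<le> q - p \<Longrightarrow> q - p \<le> of_nat m + 1
                    \<Longrightarrow> \<phi> p q \<in> R1"
    and f_boundary: "f i (i - 2) = 0" "f i (i - 1) = 1"
                    "f i (i + int m) = 1" "f i (i + int m + 1) = 0"
    and phi_boundary: "2 * p \<in> \<int> \<Longrightarrow> \<phi> p (p - 1) = 0"
                      "2 * p \<in> \<int> \<Longrightarrow> \<phi> p (p + of_nat m + 1) = 0"
    and frieze_rule: "-1 \<le> j - i \<Longrightarrow> j - i \<le> int m \<Longrightarrow>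
      (let A = f i j; B = f (i + 1) j; C = f i (j + 1); D = f (i + 1) (j + 1);
           \<Xi> = \<phi> (of_int i + 1/2) (of_int j + 1/2);
           \<Psi> = \<phi> (of_int i + 1) (of_int j + 1);
           \<Phi> = \<phi> (of_int i) (of_int j + 1);
           \<Sigma> = \<phi> (of_int i + 1/2) (of_int j + 3/2)
       in A * D - B * C = 1 + \<Sigma> * \<Xi> \<and>
          A * \<Sigma> - C * \<Xi> = \<Phi> \<and>
          B * \<Sigma> - D * \<Xi> = \<Psi>)"

definition invertible_element :: "'a::{ring, monoid_mult} \<Rightarrow> bool" where
  "invertible_element x \<longleftrightarrow> (\<exists>y. x * y = 1 \<and> y * x = 1)"

locale generic_superfrieze = superfrieze R0 R1 m f \<phi>
  for R0 R1 :: "'a::{ring, monoid_mult} set"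
    and m :: nat
    and f :: "int \<Rightarrow> int \<Rightarrow> 'a"
    and \<phi> :: "rat \<Rightarrow> rat \<Rightarrow> 'a" +
  assumes generic: "0 \<le> j - i \<Longrightarrow> j - i \<le> int m - 1 \<Longrightarrow> invertible_element (f i j)"

end

theory Submission imports Defs begin

text \<open>
  Write \<open>a\<^sub>i = f\<^sub>i\<^sub>,\<^sub>i\<close>, \<open>\<beta>\<^sub>i = \<phi>\<^sub>i\<^sub>,\<^sub>i\<close>, and \<open>\<psi> i j\<close> for the odd entry at \<open>(i + 1/2, j + 1/2)\<close>.
  A generic superfrieze can be generated from its first two rows in two ways. Moving along a
  diagonal with \<open>i\<close> fixed, the entries solve the linear recurrence
  \<open>f i j = a\<^sub>j f i (j-1) - f i (j-2) - \<beta>\<^sub>j \<phi> i (j-1)\<close>, \<open>\<phi> i j = \<phi> i (j-1) + \<beta>\<^sub>j f i (j-1)\<close>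
  (\<open>column_recurrence\<close>); moving along a diagonal with \<open>j\<close> fixed, the even entries and the
  half-integral odd entries solve
  \<open>f i j = a\<^sub>i f (i+1) j - f (i+2) j + \<beta>\<^sub>i \<psi> (i+1) j\<close>, \<open>\<psi> i j = \<psi> (i+1) j + \<beta>\<^sub>i f (i+1) j\<close>
  (\<open>row_recurrence\<close>). The coefficients are indexed by the moving end in each case.

  The boundary conditions at the far side of the array then do the work. Where a recurrence
  runs into the rows of ones and zeros, it can be solved for its coefficients, so the last
  inner rows contain the \<open>a\<close>'s and \<open>\<beta>\<close>'s again, shifted. The two recurrences
  recover them with different shifts: the same entry \<open>f (i+2) (i+m+1)\<close> equals \<open>a\<close> at
  \<open>i+m+3\<close> according to the first recurrence and \<open>a\<^sub>i\<close> according to the second. Likewise the last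
  odd rows are \<open>-\<beta>\<close> at two indices that differ by \<open>m+3\<close>, and the frieze rule for the square that
  straddles the last row of ones says that these rows are negatives of each other; this is
  where the sign comes from (\<open>first_rows_periodic\<close>). The column recurrence carries the
  periodicity of its coefficients to the whole array.

  Both recurrences come from one algebraic step across two adjacent squares
  (\<open>recurrence_step\<close>), in which the unknown corner of the second square is found by
  cancelling the opposite entry; genericity enters only there.
\<close>

section \<open>The algebra of one square\<close>

context supercommutative_ring
begin

lemma minus_one_even: "- 1 \<in> R0"
  using even_diff[OF even_zero one_even] by simp

lemma even_left_commute: "x \<in> R0 \<Longrightarrow> y * (x * z) = x * (y * z)"
  by (metis even_central mult.assoc)

lemma even_factors_out: "b \<in> R0 \<Longrightarrow> (a * x) * (b * y) = (a * b) * (x * y)"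
  by (metis even_central mult.assoc)

lemma odd_square_assoc: "x \<in> R1 \<Longrightarrow> x * (x * z) = 0"
  by (metis odd_square mult.assoc mult_zero_left)

lemma invertible_cancel:
  assumes "invertible_element b" "b * x = b * y"
  shows "x = y"
proof -
  obtain c where "c * b = 1"
    using assms(1) unfolding invertible_element_def by blast
  then show ?thesis
    using assms(2) by (metis mult.assoc mult_1_left)
qed

text \<open>
  The two odd relations of the frieze rule are a linear system for \<open>s\<close> and \<open>x\<close> with
  determinant \<open>-(A * D - B * C) = -(1 + s * x)\<close>. As \<open>s\<close> and \<open>x\<close> are annihilated by \<open>s * x\<close>,
  the determinant acts on them as \<open>-1\<close>, and Cramer's rule inverts the system without any
  division. A square can thus be described equally well by the integral and by the half-integral
  pair of its odd entries.
\<close>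

lemma square_dual:
  assumes ev: "A \<in> R0" "B \<in> R0" "C \<in> R0" "D \<in> R0"
    and od: "s \<in> R1" "x \<in> R1"
    and det: "A * D - B * C = 1 + s * x"
    and p: "A * s - C * x = p" and q: "B * s - D * x = q"
  shows "D * p - C * q = s" "B * p - A * q = x" "q * p = s * x"
proof -
  have xs: "x * s = - (s * x)"
    using od odd_anticommute by blast
  have sxs: "s * (x * s) = 0" "s * (x * x) = 0" "(s * x) * (s * x) = 0"
    using od by (simp_all add: xs odd_square odd_square_assoc mult.assoc)
      (metis xs mult.assoc mult_minus_right mult_zero_left odd_square neg_0_equal_iff_equal)
  have "D * p - C * q = (A * D - B * C) * s"
    unfolding p[symmetric] q[symmetric] right_diff_distrib left_diff_distrib
    using ev even_left_commute[of D C x]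
    by (simp add: mult.assoc even_left_commute[of A D] even_left_commute[of B C])
  then show "D * p - C * q = s"
    by (simp add: det distrib_right mult.assoc sxs)
  have "B * p - A * q = (A * D - B * C) * x"
    unfolding p[symmetric] q[symmetric] right_diff_distrib left_diff_distrib
    using ev even_left_commute[of B A s] by (simp add: mult.assoc)
  then show "B * p - A * q = x"
    by (simp add: det distrib_right mult.assoc sxs)
  have "q * p = B * s * (A * s) - B * s * (C * x) - (D * x * (A * s) - D * x * (C * x))"
    unfolding p[symmetric] q[symmetric] by (simp only: right_diff_distrib left_diff_distrib) simp
  also have "\<dots> = (A * D - B * C) * (s * x)"
    using ev od even_central[of A D]
    by (simp add: even_factors_out odd_square xs left_diff_distrib)
  also have "\<dots> = s * x"
    by (simp add: det distrib_right sxs)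
  finally show "q * p = s * x" .
qed

text \<open>
  Two adjacent squares share the side with entries \<open>A\<close> and \<open>B\<close>: one has the corners
  \<open>A', B', A, B\<close>, the other \<open>A, B, C, D\<close>. The side \<open>B', B, D\<close> is assumed to follow the
  recurrence with coefficients \<open>a\<close>, \<open>\<beta>\<close>, and so does then the side \<open>A', A, C\<close>: after
  multiplication by \<open>B\<close>, both claims follow from the determinants and the common odd entry \<open>same\<close>
  of the two squares, and \<open>B\<close> cancels. The even factor \<open>e\<close> will be \<open>1\<close> or \<open>-1\<close>: exchanging
  rows and columns of the array reverses the order of the odd factors in the determinants,
  which changes their sign.
\<close>

lemma recurrence_step:
  assumes ev: "A \<in> R0" "A' \<in> R0" "B \<in> R0" "a \<in> R0" "e \<in> R0"
    and od: "P' \<in> R1" "Q' \<in> R1" "\<beta> \<in> R1"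
    and inv: "invertible_element B"
    and det: "A * D - B * C = 1 + e * (Q * P)"
    and det': "A' * B - B' * A = 1 + e * (Q' * P')"
    and same: "B * P - A * Q = B * P' - A * Q'"
    and D: "D = a * B - B' - e * (\<beta> * Q')"
    and Q: "Q = Q' + \<beta> * B"
  shows "C = a * A - A' - e * (\<beta> * P')" "P = P' + \<beta> * A"
proof -
  have "B * P = B * (P' + \<beta> * A)"
  proof -
    have "A * (\<beta> * B) = B * (\<beta> * A)"
      using ev by (metis even_central mult.assoc)
    with same show ?thesis by (simp add: Q distrib_left algebra_simps)
  qed
  then show P: "P = P' + \<beta> * A"
    using inv invertible_cancel by blast
  have comm: "Q' * \<beta> = - (\<beta> * Q')"
    by (rule odd_anticommute[OF od(2,3)])
  have "B * C = A * D - (1 + e * (Q' * P')) + e * (Q' * P') - e * (Q * P)"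
    using det by (simp add: algebra_simps)
  then have BC: "B * C = A * D - A' * B + B' * A + e * (Q' * P') - e * (Q * P)"
    unfolding det'[symmetric] by (simp add: algebra_simps)
  have QP: "Q * P = Q' * P' - A * (\<beta> * Q') + B * (\<beta> * P')"
  proof -
    have "Q' * (\<beta> * A) = - (A * (\<beta> * Q'))" "\<beta> * B * P' = B * (\<beta> * P')"
      "\<beta> * B * (\<beta> * A) = 0"
      using ev od comm by (metis even_central mult.assoc mult_minus_right,
          metis even_central mult.assoc,
          metis even_central mult.assoc odd_square mult_zero_left mult_zero_right)
    then show ?thesis by (simp add: P Q distrib_left distrib_right)
  qed
  have AD: "A * D = A * (a * B) - A * B' - e * (A * (\<beta> * Q'))"
    unfolding D using ev by (metis even_left_commute right_diff_distrib)
  have "B * C = A * (a * B) - A' * B - e * (B * (\<beta> * P'))"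
    unfolding BC AD QP using even_central[OF ev(1), of B']
    by (simp add: distrib_left right_diff_distrib)
  also have "\<dots> = B * (a * A - A' - e * (\<beta> * P'))"
  proof -
    have "A * (a * B) = B * (a * A)" "A' * B = B * A'"
      "e * (B * (\<beta> * P')) = B * (e * (\<beta> * P'))"
      using ev by (metis even_central mult.assoc)+
    then show ?thesis by (simp add: right_diff_distrib)
  qed
  finally show "C = a * A - A' - e * (\<beta> * P')"
    using inv invertible_cancel by blast
qed

end

section \<open>Squares of a superfrieze\<close>

context superfrieze
begin

definition phi_int :: "int \<Rightarrow> int \<Rightarrow> 'a" where
  "phi_int i j = \<phi> (of_int i) (of_int j)"

text \<open>The odd entries at half-integral positions, labelled by the integers just below.\<close>

definition phi_half :: "int \<Rightarrow> int \<Rightarrow> 'a" where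
  "phi_half i j = \<phi> (of_int i + 1/2) (of_int j + 1/2)"

lemma of_int_diff_bounds:
  assumes "-1 \<le> j - i" "j - i \<le> int m + 1"
  shows "- 1 \<le> (of_int j :: rat) - of_int i" "(of_int j :: rat) - of_int i \<le> of_nat m + 1"
proof -
  have "of_int (- 1) \<le> (of_int (j - i) :: rat)" "(of_int (j - i) :: rat) \<le> of_int (int m + 1)"
    using assms of_int_le_iff by blast+
  then show "- 1 \<le> (of_int j :: rat) - of_int i" "(of_int j :: rat) - of_int i \<le> of_nat m + 1"
    by simp_all
qed

lemma phi_int_odd: "-1 \<le> j - i \<Longrightarrow> j - i \<le> int m + 1 \<Longrightarrow> phi_int i j \<in> R1"
  unfolding phi_int_def using of_int_diff_bounds[of j i]
  by (intro phi_odd) (auto simp: half_integer_pair_def)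

lemma phi_half_odd: "-1 \<le> j - i \<Longrightarrow> j - i \<le> int m + 1 \<Longrightarrow> phi_half i j \<in> R1"
  unfolding phi_half_def using of_int_diff_bounds[of j i]
  by (intro phi_odd) (auto simp: half_integer_pair_def)

lemma phi_int_boundary: "phi_int i (i - 1) = 0" "phi_int i (i + int m + 1) = 0"
  using phi_boundary[of "of_int i"] by (simp_all add: phi_int_def)

lemma phi_half_boundary: "phi_half i (i - 1) = 0" "phi_half i (i + int m + 1) = 0"
proof -
  have "2 * (of_int i + 1/2 :: rat) = of_int (2 * i + 1)" by simp
  then have "2 * (of_int i + 1/2 :: rat) \<in> \<int>" using Ints_of_int by metis
  from phi_boundary[OF this]
  show "phi_half i (i - 1) = 0" "phi_half i (i + int m + 1) = 0"
    by (simp_all add: phi_half_def algebra_simps)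
qed

lemma square:
  assumes "-1 \<le> j - i" "j - i \<le> int m"
  shows "f i j * f (i + 1) (j + 1) - f (i + 1) j * f i (j + 1) = 1 + phi_half i (j + 1) * phi_half i j"
    and "f i j * phi_half i (j + 1) - f i (j + 1) * phi_half i j = phi_int i (j + 1)"
    and "f (i + 1) j * phi_half i (j + 1) - f (i + 1) (j + 1) * phi_half i j = phi_int (i + 1) (j + 1)"
proof -
  have "phi_half i (j + 1) = \<phi> (of_int i + 1/2) (of_int j + 3/2)"
    by (simp add: phi_half_def add.commute)
  then show "f i j * f (i + 1) (j + 1) - f (i + 1) j * f i (j + 1) = 1 + phi_half i (j + 1) * phi_half i j"
    and "f i j * phi_half i (j + 1) - f i (j + 1) * phi_half i j = phi_int i (j + 1)"
    and "f (i + 1) j * phi_half i (j + 1) - f (i + 1) (j + 1) * phi_half i j = phi_int (i + 1) (j + 1)"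
    using frieze_rule[OF assms] by (simp_all add: phi_half_def[of i j] phi_int_def Let_def)
qed

lemma square_in_integer_entries:
  assumes "-1 \<le> j - i" "j - i \<le> int m"
  shows "f (i + 1) (j + 1) * phi_int i (j + 1) - f i (j + 1) * phi_int (i + 1) (j + 1) = phi_half i (j + 1)"
    and "f (i + 1) j * phi_int i (j + 1) - f i j * phi_int (i + 1) (j + 1) = phi_half i j"
    and "phi_int (i + 1) (j + 1) * phi_int i (j + 1) = phi_half i (j + 1) * phi_half i j"
  using assms
  by (intro square_dual[OF _ _ _ _ _ _ square[OF assms]]; force intro: f_even phi_half_odd)+

lemma first_rows_agree: "phi_half i i = phi_int i i"
  using square(2)[of "i - 1" i] by (simp add: f_boundary phi_half_boundary)

end

section \<open>The two linear recurrences\<close>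

context generic_superfrieze
begin

lemma generic_with_boundary:
  assumes "-1 \<le> j - i" "j - i \<le> int m"
  shows "invertible_element (f i j)"
proof -
  have one: "invertible_element (1 :: 'a)" unfolding invertible_element_def by auto
  consider "j = i - 1" | "j = i + int m" | "0 \<le> j - i" "j - i \<le> int m - 1"
    using assms by linarith
  then show ?thesis
    by cases (simp_all add: one f_boundary generic)
qed

text \<open>
  Induction on \<open>k = j - i\<close>, simultaneously for all \<open>i\<close>: the
  recurrence ending in \<open>(i + 1, j)\<close> is transported to \<open>(i, j)\<close> across the two squares between
  the diagonals \<open>i\<close> and \<open>i + 1\<close>. The odd entry that these squares share is half-integral, which
  is why it has to be expressed by integral entries.
\<close>

lemma column_recurrence_nat:
  assumes "k \<le> m + 1" "j = i + int k"
  shows "f i j = f j j * f i (j - 1) - f i (j - 2) - phi_int j j * phi_int i (j - 1)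
       \<and> phi_int i j = phi_int i (j - 1) + phi_int j j * f i (j - 1)"
  using assms
proof (induction k arbitrary: i j)
  case 0
  then show ?case by (simp add: f_boundary phi_int_boundary)
next
  case (Suc k)
  define l where "l = j - 1"
  have j: "j = l + 1" and k: "l - i = int k" "k \<le> m" using Suc.prems by (auto simp: l_def)
  have IH: "f (i + 1) j = f j j * f (i + 1) (j - 1) - f (i + 1) (j - 2) - phi_int j j * phi_int (i + 1) (j - 1)"
    "phi_int (i + 1) j = phi_int (i + 1) (j - 1) + phi_int j j * f (i + 1) (j - 1)"
    using Suc.IH[of j "i + 1"] Suc.prems by auto
  have ev: "f i l \<in> R0" "f i (l - 1) \<in> R0" "f (i + 1) l \<in> R0" "f j j \<in> R0"
    using k by (simp_all add: f_even)
  have od: "phi_int i l \<in> R1" "phi_int (i + 1) l \<in> R1" "phi_int j j \<in> R1"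
    using k by (simp_all add: phi_int_odd)
  have inv: "invertible_element (f (i + 1) l)"
    using k by (simp add: generic_with_boundary)
  have det: "f i l * f (i + 1) j - f (i + 1) l * f i j = 1 + 1 * (phi_int (i + 1) j * phi_int i j)"
    using square(1)[of l i] square_in_integer_entries(3)[of l i] k by (simp add: j)
  have det': "f i (l - 1) * f (i + 1) l - f (i + 1) (l - 1) * f i l
      = 1 + 1 * (phi_int (i + 1) l * phi_int i l)"
    using square(1)[of "l - 1" i] square_in_integer_entries(3)[of "l - 1" i] k by simp
  have same: "f (i + 1) l * phi_int i j - f i l * phi_int (i + 1) j
      = f (i + 1) l * phi_int i l - f i l * phi_int (i + 1) l"
    using square_in_integer_entries(2)[of l i] square_in_integer_entries(1)[of "l - 1" i] k
    by (simp add: j)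
  have D: "f (i + 1) j = f j j * f (i + 1) l - f (i + 1) (l - 1) - 1 * (phi_int j j * phi_int (i + 1) l)"
    and Q: "phi_int (i + 1) j = phi_int (i + 1) l + phi_int j j * f (i + 1) l"
    using IH by (simp_all add: j)
  show ?case
    using recurrence_step[OF ev one_even od inv det det' same D Q] by (simp add: j)
qed

text \<open>
  The mirror image, transporting the recurrence from \<open>(i, j - 1)\<close> to \<open>(i, j)\<close>. The half-integral
  entries now take the part of the integral ones, and the odd entry shared by the two squares is
  the integral one at \<open>(i + 1, j)\<close>.
\<close>

lemma row_recurrence_nat:
  assumes "k \<le> m + 1" "j = i + int k"
  shows "f i j = f i i * f (i + 1) j - f (i + 2) j + phi_int i i * phi_half (i + 1) j
       \<and> phi_half i j = phi_half (i + 1) j + phi_int i i * f (i + 1) j"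
  using assms
proof (induction k arbitrary: i j)
  case 0
  then show ?case
    using f_boundary(1)[of "i + 2"] f_boundary(2)[of "i + 1"] phi_half_boundary(1)[of "i + 1"]
    by (simp add: first_rows_agree)
next
  case (Suc k)
  define l where "l = j - 1"
  have j: "j = l + 1" and k: "l - i = int k" "k \<le> m" using Suc.prems by (auto simp: l_def)
  have IH: "f i l = f i i * f (i + 1) l - f (i + 2) l + phi_int i i * phi_half (i + 1) l"
    "phi_half i l = phi_half (i + 1) l + phi_int i i * f (i + 1) l"
    using Suc.IH[of l i] Suc.prems by (auto simp: l_def)
  have ev: "f (i + 1) j \<in> R0" "f (i + 2) j \<in> R0" "f (i + 1) l \<in> R0" "f i i \<in> R0"
    using k by (simp_all add: f_even j)
  have od: "phi_half (i + 1) j \<in> R1" "phi_half (i + 1) l \<in> R1" "phi_int i i \<in> R1"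
    and od': "phi_half i j \<in> R1" "phi_half i l \<in> R1"
    using k by (simp_all add: phi_int_odd phi_half_odd j)
  have inv: "invertible_element (f (i + 1) l)"
    using k by (simp add: generic_with_boundary)
  have det: "f (i + 1) j * f i l - f (i + 1) l * f i j = 1 + (- 1) * (phi_half i l * phi_half i j)"
    using square(1)[of l i] k even_central[OF ev(1), of "f i l"] odd_anticommute[OF od']
    by (simp add: j)
  have det': "f (i + 2) j * f (i + 1) l - f (i + 2) l * f (i + 1) j
      = 1 + (- 1) * (phi_half (i + 1) l * phi_half (i + 1) j)"
    using square(1)[of l "i + 1"] k even_central[OF ev(2), of "f (i + 1) l"]
      odd_anticommute[OF od(1,2)]
    by (simp add: j add.assoc)
  have same: "f (i + 1) l * phi_half i j - f (i + 1) j * phi_half i l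
      = f (i + 1) l * phi_half (i + 1) j - f (i + 1) j * phi_half (i + 1) l"
    using square(3)[of l i] square(2)[of l "i + 1"] k by (simp add: j)
  have D: "f i l = f i i * f (i + 1) l - f (i + 2) l - (- 1) * (phi_int i i * phi_half (i + 1) l)"
    and Q: "phi_half i l = phi_half (i + 1) l + phi_int i i * f (i + 1) l"
    using IH by simp_all
  show ?case
    using recurrence_step[OF ev minus_one_even od inv det det' same D Q] by simp
qed

lemma column_recurrence:
  assumes "0 \<le> j - i" "j - i \<le> int m + 1"
  shows "f i j = f j j * f i (j - 1) - f i (j - 2) - phi_int j j * phi_int i (j - 1)"
    and "phi_int i j = phi_int i (j - 1) + phi_int j j * f i (j - 1)"
  using column_recurrence_nat[of "nat (j - i)" j i] assms by simp_all

lemma row_recurrence: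
  assumes "0 \<le> j - i" "j - i \<le> int m + 1"
  shows "f i j = f i i * f (i + 1) j - f (i + 2) j + phi_int i i * phi_half (i + 1) j"
    and "phi_half i j = phi_half (i + 1) j + phi_int i i * f (i + 1) j"
  using row_recurrence_nat[of "nat (j - i)" j i] assms by simp_all

section \<open>Periodicity\<close>

text \<open>
  At \<open>j = i + m + 1\<close> the left-hand sides of the recurrence vanish and \<open>f i (j - 1) = 1\<close>, so
  it can be solved for its coefficients; the product of odd entries drops out as
  \<open>\<beta>\<^sub>j \<beta>\<^sub>j = 0\<close>.
\<close>

lemma last_rows_columnwise:
  "phi_int i (i + int m) = - phi_int (i + int m + 1) (i + int m + 1)"
  "f i (i + int m - 1) = f (i + int m + 1) (i + int m + 1)"
proof -
  let ?j = "i + int m + 1"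
  have "0 = phi_int i (i + int m) + phi_int ?j ?j"
    using column_recurrence(2)[of ?j i] by (simp add: f_boundary phi_int_boundary)
  then show phi: "phi_int i (i + int m) = - phi_int ?j ?j"
    by (simp add: eq_neg_iff_add_eq_0)
  have "?j - 2 = i + int m - 1" by simp
  then have "0 = f ?j ?j - f i (i + int m - 1) - phi_int ?j ?j * phi_int i (i + int m)"
    using column_recurrence(1)[of ?j i] by (simp add: f_boundary)
  then show "f i (i + int m - 1) = f ?j ?j"
    using odd_square[OF phi_int_odd[of ?j ?j]] by (simp add: phi)
qed

text \<open>The same evaluation of the other recurrence, which recovers the coefficients at the other end.\<close>

lemma last_rows_rowwise:
  "phi_half (i + 1) (i + 1 + int m) = - phi_int i i"
  "f (i + 2) (i + 2 + int m - 1) = f i i"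
proof -
  let ?j = "i + int m + 1"
  have j: "i + 1 + int m = ?j" "i + 2 + int m - 1 = ?j" by simp_all
  have one: "f (i + 1) ?j = 1"
    using f_boundary(3)[of "i + 1"] by (simp add: algebra_simps)
  have "0 = phi_half (i + 1) ?j + phi_int i i"
    using row_recurrence(2)[of ?j i] by (simp add: one phi_half_boundary)
  then show phi: "phi_half (i + 1) (i + 1 + int m) = - phi_int i i"
    unfolding j by (simp add: eq_neg_iff_add_eq_0)
  have "0 = f i i - f (i + 2) ?j + phi_int i i * phi_half (i + 1) ?j"
    using row_recurrence(1)[of ?j i] by (simp add: f_boundary one)
  then show "f (i + 2) (i + 2 + int m - 1) = f i i"
    unfolding j using odd_square[OF phi_int_odd[of i i]] phi by (simp add: j)
qed

lemma first_rows_periodic: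
  "f (i + int (m + 3)) (i + int (m + 3)) = f i i"
  "phi_int (i + int (m + 3)) (i + int (m + 3)) = - phi_int i i"
proof -
  have n: "i + 2 + int m + 1 = i + int (m + 3)" by simp
  show "f (i + int (m + 3)) (i + int (m + 3)) = f i i"
    using last_rows_columnwise(2)[of "i + 2"] last_rows_rowwise(2)[of i] unfolding n by simp
  \<comment> \<open>the square at \<open>(i + 1, i + 1 + m)\<close>, in which \<open>C = 0\<close>, \<open>D = 1\<close> and \<open>\<Sigma> = 0\<close>\<close>
  have "phi_half (i + 1) (i + 1 + int m) = - phi_int (i + 2) (i + 2 + int m)"
    using square(3)[of "i + 1 + int m" "i + 1"] f_boundary(3)[of "i + 2"]
      phi_half_boundary(2)[of "i + 1"]
    by (simp add: algebra_simps eq_neg_iff_add_eq_0)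
  then show "phi_int (i + int (m + 3)) (i + int (m + 3)) = - phi_int i i"
    using last_rows_columnwise(1)[of "i + 2"] last_rows_rowwise(1)[of i] unfolding n by simp
qed

text \<open>
  The recurrence is of second order in \<open>f\<close>, hence the induction carries two consecutive even
  entries. The signs are consistent: each term of the recurrence for \<open>f\<close> has an even
  number of odd factors, each term of the one for \<open>\<phi>\<close> exactly one.
\<close>

lemma column_periodic:
  assumes "k \<le> m + 2" "j = i - 1 + int k"
  shows "f (i + int (m + 3)) (j + int (m + 3)) = f i j \<and>
    f (i + int (m + 3)) (j - 1 + int (m + 3)) = f i (j - 1) \<and>
    phi_int (i + int (m + 3)) (j + int (m + 3)) = - phi_int i j"
  using assms
proof (induction k arbitrary: j)
  case 0
  have "i + int (m + 3) - 1 = j + int (m + 3)" "i + int (m + 3) - 2 = j - 1 + int (m + 3)"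
    using 0 by simp_all
  then show ?case
    using 0 f_boundary(1,2)[of "i + int (m + 3)"] f_boundary(1,2)[of i]
      phi_int_boundary(1)[of "i + int (m + 3)"] phi_int_boundary(1)[of i] by simp
next
  case (Suc k)
  let ?n = "int (m + 3)"
  have IH: "f (i + ?n) (j + ?n - 1) = f i (j - 1)" "f (i + ?n) (j + ?n - 2) = f i (j - 2)"
    "phi_int (i + ?n) (j + ?n - 1) = - phi_int i (j - 1)"
    using Suc.IH[of "j - 1"] Suc.prems by (auto simp: algebra_simps)
  have "0 \<le> j - i" "j - i \<le> int m + 1" using Suc.prems by auto
  note old = column_recurrence[OF this]
  have "0 \<le> (j + ?n) - (i + ?n)" "(j + ?n) - (i + ?n) \<le> int m + 1" using Suc.prems by auto
  note new = column_recurrence[OF this, unfolded IH first_rows_periodic]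
  show ?case unfolding new unfolding old using IH by (simp add: algebra_simps)
qed

lemma periodic:
  "-2 \<le> j - i \<Longrightarrow> j - i \<le> int m + 1 \<Longrightarrow> f (i + int (m + 3)) (j + int (m + 3)) = f i j"
  "-1 \<le> j - i \<Longrightarrow> j - i \<le> int m + 1 \<Longrightarrow>
     phi_int (i + int (m + 3)) (j + int (m + 3)) = - phi_int i j"
proof -
  show "phi_int (i + int (m + 3)) (j + int (m + 3)) = - phi_int i j"
    if "-1 \<le> j - i" "j - i \<le> int m + 1"
    using column_periodic[of "nat (j - i + 1)" j i] that by simp
  show "f (i + int (m + 3)) (j + int (m + 3)) = f i j" if "-2 \<le> j - i" "j - i \<le> int m + 1"
  proof (cases "j = i - 2")
    case True
    then show ?thesis using column_periodic[of 0 "i - 1" i] by simp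
  next
    case False
    then show ?thesis using column_periodic[of "nat (j - i + 1)" j i] that by simp
  qed
qed

end

theorem lemma2p6p1:
  fixes R0 R1 :: "'a::{ring, monoid_mult} set"
    and m n :: nat
    and f :: "int \<Rightarrow> int \<Rightarrow> 'a"
    and \<phi> :: "rat \<Rightarrow> rat \<Rightarrow> 'a"
  assumes "generic_superfrieze R0 R1 m f \<phi>"
    and "n = m + 3"
  shows "(\<forall>i j :: int. -1 \<le> j - i \<and> j - i \<le> int m + 1 \<longrightarrow>
            \<phi> (of_int (i + int n)) (of_int (j + int n)) = - \<phi> (of_int i) (of_int j)) \<and>
         (\<forall>i j :: int. -2 \<le> j - i \<and> j - i \<le> int m + 1 \<longrightarrow>
            f (i + int n) (j + int n) = f i j) \<and>
         (\<forall>i :: int. f (i + int n) (i + int n) = f i i) \<and>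
         (\<forall>i :: int. \<phi> (of_int (i + int n)) (of_int (i + int n)) = - \<phi> (of_int i) (of_int i))"
proof -
  interpret generic_superfrieze R0 R1 m f \<phi> by (fact assms(1))
  show ?thesis
    using periodic unfolding phi_int_def assms(2)[symmetric] by simp
qed

end
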